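(* Let $k=2$, so that the memory kernel is $$g(t)=\left(\theta_1+\theta_2\,t+\tfrac12\theta_3\,t^2\right)e^{-t},$$ with $\theta_1>0$ and $\theta_2,\theta_3\ge0$, and let $\Lambda(\xi)$, $\xi\in\mathbb{R}$, be the set of roots of the associated dispersion relation. Then there exists $c_0>0$ such that $$\mathrm{Re}\,\lambda\le-\frac{c_0|\xi|^2}{1+|\xi|^2}\qquad\text{for all }\xi\in\mathbb{R}\text{ and all }\lambda\in\Lambda(\xi)$$ if and only if $$\theta_2<\theta_1\quad\text{and}\quad\Bigl(\;3\theta_3<2\theta_1\quad\text{or}\quad(2\theta_2+\theta_3)^2+8(\theta_3-\theta_1)^2<8\theta_1^2\;\Bigr).$$
   Context: For $\boldsymbol{\theta}=(\theta_1,\theta_2,\theta_3)$, the kernel is $g=\theta_1g_1+\theta_2g_2+\theta_3g_3$ with $g_j(t)=\frac{1}{(j-1)!}t^{j-1}e^{-t}$ (Gamma distributions with scale $\tau=1$). The memory diffusion equation $\partial_t u(x,t)-\int_{-\infty}^t g(t-s)\,\partial_{xx}u(x,s)\,ds=0$ is then equivalent to the system, for $(u,\mathbf{v})\in\mathbb{R}^{4}$, $$\partial_t u+\partial_x(\boldsymbol{\theta}\cdot\mathbf{v})=0,\qquad \partial_t\mathbf{v}+\mathbf{e}_1\,\partial_x u+(\mathbb{I}_{3}-\mathbb{N}_{3})\mathbf{v}=0,$$ where $\mathbf{e}_1=(1,0,0)$, $\mathbb{I}_3$ is the identity matrix and $\mathbb{N}_3$ is the $3\times3$ matrix with $1$ on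 the subdiagonal and $0$ elsewhere. For $\lambda,\mu\in\mathbb{C}$ set $$p(\lambda,\mu):=\det\begin{pmatrix}\lambda & \mu\,\boldsymbol{\theta}\\ \mu\,\mathbf{e}_1 & (\lambda+1)\mathbb{I}_{3}-\mathbb{N}_{3}\end{pmatrix}$$ (a $4\times4$ determinant, with $\boldsymbol{\theta}$ regarded as a row and $\mathbf{e}_1$ as a column). The dispersion relation is $p(\lambda,\mu)=0$, and $\Lambda(\xi):=\{\lambda\in\mathbb{C} : p(\lambda,i\xi)=0\}$ for $\xi\in\mathbb{R}$. *)

theory Defs
  imports Complex_Main "Jordan_Normal_Form.Determinant"
begin

text \<open>Density of the Gamma distribution with shape \<open>j \<ge> 1\<close> and scale \<open>1\<close>, at \<open>t \<ge> 0\<close>.\<close>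

definition gamma_kernel :: "nat \<Rightarrow> real \<Rightarrow> real" where
  "gamma_kernel j t = 1 / fact (j - 1) * t ^ (j - 1) * exp (- t)"

text \<open>The entry \<open>\<theta> $ i\<close> of the zero-based vector is the coefficient \<open>\<theta>\<^sub>i\<^sub>+\<^sub>1\<close>.\<close>

definition memory_kernel :: "real vec \<Rightarrow> real \<Rightarrow> real" where
  "memory_kernel \<theta> t = (\<Sum>j = 1..dim_vec \<theta>. \<theta> $ (j - 1) * gamma_kernel j t)"

lemma memory_kernel_3:
  "memory_kernel (vec_of_list [\<theta>1, \<theta>2, \<theta>3]) t =
     (\<theta>1 + \<theta>2 * t + 1 / 2 * \<theta>3 * t ^ 2) * exp (- t)"
proof -
  have "{1..3::nat} = {1, 2, 3}"
    by auto
  then show ?thesis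
    by (simp add: memory_kernel_def gamma_kernel_def vec_of_list_index field_simps
        numeral_eq_Suc)
qed

definition subdiag_mat :: "nat \<Rightarrow> 'a :: {zero,one} mat" where
  "subdiag_mat n = mat n n (\<lambda>(i, j). if i = Suc j then 1 else 0)"

text \<open>
  The system equivalent to the memory diffusion equation with kernel \<open>memory_kernel \<theta>\<close> is
  \<open>\<partial>\<^sub>t u + \<partial>\<^sub>x (\<theta> \<bullet> v) = 0\<close>, \<open>\<partial>\<^sub>t v + e\<^sub>1 \<partial>\<^sub>x u + (I - N) v = 0\<close>; its symbol is obtained by replacing
  \<open>\<partial>\<^sub>t\<close> with \<open>z\<close> and \<open>\<partial>\<^sub>x\<close> with \<open>\<mu>\<close>. The vector \<open>e\<^sub>1\<close> is \<open>unit_vec n 0\<close>.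
\<close>

definition symbol_mat :: "real vec \<Rightarrow> complex \<Rightarrow> complex \<Rightarrow> complex mat" where
  "symbol_mat \<theta> z \<mu> = (let n = dim_vec \<theta> in
     four_block_mat
       (mat 1 1 (\<lambda>_. z))
       (\<mu> \<cdot>\<^sub>m mat_of_row (map_vec complex_of_real \<theta>))
       (\<mu> \<cdot>\<^sub>m mat_of_cols n [unit_vec n 0])
       ((z + 1) \<cdot>\<^sub>m (1\<^sub>m n) - subdiag_mat n))"

definition dispersion_det :: "real vec \<Rightarrow> complex \<Rightarrow> complex \<Rightarrow> complex" where
  "dispersion_det \<theta> z \<mu> = det (symbol_mat \<theta> z \<mu>)"

definition dispersion_roots :: "real vec \<Rightarrow> real \<Rightarrow> complex set" where
  "dispersion_roots \<theta> \<xi> = {z. dispersion_det \<theta> z (\<i> * complex_of_real \<xi>) = 0}"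

end

theory Submission
  imports Defs "HOL-Analysis.Elementary_Metric_Spaces" "HOL-Analysis.Product_Vector"
begin

text \<open>
  Write \<open>a, b, c\<close> for \<open>\<theta>1, \<theta>2, \<theta>3\<close>. Expanding the determinant, the dispersion relation at \<open>\<mu> = \<i> \<xi>\<close> is
  \<open>z (1 + z)\<^sup>3 + \<xi>\<^sup>2 (a (1 + z)\<^sup>2 + b (1 + z) + c) = 0\<close>, a real quartic in \<open>z\<close>. With \<open>\<sigma> = \<xi>\<^sup>2 / (1 + \<xi>\<^sup>2)\<close>
  it becomes the convex combination \<open>pencil a b c \<sigma> z = 0\<close> of its low- and high-frequency parts,
  and the required bound is \<open>Re z \<le> - c0 \<sigma>\<close>. The frequency \<open>\<xi> = \<infinity>\<close> is thereby turned into the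
  endpoint \<open>\<sigma> = 1\<close> of a compact interval, where the quartic degenerates to a quadratic; uniformity
  of the decay rate is a matter of keeping a strict inequality up to that point.

  The bound with rate \<open>g\<close> says that the quartic in \<open>z + g \<sigma>\<close> has no root of positive real part. By
  the Routh--Hurwitz criterion this is governed by the sign of one polynomial,
  \<open>hurwitz_margin a b c \<sigma> (g \<sigma>)\<close>, since the other Hurwitz conditions hold automatically for
  \<open>0 < \<sigma> < 1\<close> and small \<open>g\<close> (lemmas \<open>shift_positive\<close> and \<open>shift0_positive\<close>). If the polynomial is
  positive at \<open>g = 0\<close> for all \<open>\<sigma> \<in> [0, 1]\<close>, it stays positive for small \<open>g > 0\<close> by compactness, which
  gives a decay rate. Conversely, it equals \<open>8\<close> at \<open>\<sigma> = 0\<close>, so if it failed to be positive somewhere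
  in \<open>[0, 1)\<close> it would vanish at some point, where the shifted quartic has a root on the imaginary
  axis (\<open>quartic_imaginary_root\<close>), contradicting any rate larger than \<open>g\<close>. Using this with \<open>g = 0\<close>
  handles \<open>\<sigma> < 1\<close>; using it with some \<open>g > 0\<close> and letting \<open>\<sigma> \<rightarrow> 1\<close> handles the endpoint. This is
  \<open>decay_iff_hurwitz_margin_pos\<close>.

  At \<open>g = 0\<close> the polynomial is the binary quadratic form
  \<open>8 (1 - \<sigma>)\<^sup>2 + (8a - 2b - 9c) \<sigma> (1 - \<sigma>) + (2a + b)(a - b) \<sigma>\<^sup>2\<close>. Its value at \<open>\<sigma> = 1\<close> produces the
  condition \<open>b < a\<close>, its discriminant is nine times \<open>(2b + c)\<^sup>2 + 8 (c - a)\<^sup>2 - 8 a\<^sup>2\<close>, and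
  \<open>hurwitz_margin_pos_iff\<close> shows that the condition on the sign of the middle coefficient may be
  traded for \<open>3c < 2a\<close>.
\<close>

section \<open>The dispersion relation on a compact frequency interval\<close>

lemmas small_powers = power2_eq_square power3_eq_cube power4_eq_xxxx

lemma det_dim_two:
  fixes A :: "'a :: comm_ring_1 mat"
  assumes "A \<in> carrier_mat 2 2"
  shows "det A = A $$ (0, 0) * A $$ (1, 1) - A $$ (0, 1) * A $$ (1, 0)"
proof -
  have "mat_delete A i 1 \<in> carrier_mat 1 1" if "i < 2" for i
    using assms mat_delete_carrier[of A 2 2] by simp
  then show ?thesis
    using assms
    by (simp add: laplace_expansion_column[OF assms, of 1] cofactor_def det_single numeral_2_eq_2)
      (simp add: mat_delete_def)
qed

lemma det_dim_three:
  fixes A :: "'a :: comm_ring_1 mat"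
  assumes "A \<in> carrier_mat 3 3"
  shows "det A =
      A $$ (0, 2) * (A $$ (1, 0) * A $$ (2, 1) - A $$ (1, 1) * A $$ (2, 0))
    - A $$ (1, 2) * (A $$ (0, 0) * A $$ (2, 1) - A $$ (0, 1) * A $$ (2, 0))
    + A $$ (2, 2) * (A $$ (0, 0) * A $$ (1, 1) - A $$ (0, 1) * A $$ (1, 0))"
proof -
  have three: "{..<3::nat} = {0, 1, 2}"
    by auto
  have "mat_delete A i 2 \<in> carrier_mat 2 2" for i
    using assms mat_delete_carrier[of A 3 3] by simp
  then have minor: "det (mat_delete A i 2) = mat_delete A i 2 $$ (0, 0) * mat_delete A i 2 $$ (1, 1)
      - mat_delete A i 2 $$ (0, 1) * mat_delete A i 2 $$ (1, 0)" for i
    by (rule det_dim_two)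
  have "det A = (\<Sum>i<3. A $$ (i, 2) * cofactor A i 2)"
    by (rule laplace_expansion_column[OF assms]) simp
  then show ?thesis
    using assms
    by (simp add: three cofactor_def minor) (simp add: mat_delete_def numeral_2_eq_2 right_diff_distrib)
qed

lemma dispersion_det_3:
  "dispersion_det (vec_of_list [\<theta>1, \<theta>2, \<theta>3]) z \<mu> =
     z * (1 + z) ^ 3
     - \<mu>\<^sup>2 * (of_real \<theta>1 * (1 + z)\<^sup>2 + of_real \<theta>2 * (1 + z) + of_real \<theta>3)"
proof -
  define w where "w = 1 + z"
  define M where "M = Matrix.mat 4 4 (\<lambda>(i, j).
    [[z, \<mu> * of_real \<theta>1, \<mu> * of_real \<theta>2, \<mu> * of_real \<theta>3],
     [\<mu>, w, 0, 0], [0, -1, w, 0], [0, 0, -1, w]] ! i ! j)"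
  have less4: "i < 4 \<longleftrightarrow> i = 0 \<or> i = 1 \<or> i = 2 \<or> i = 3" for i :: nat
    by auto
  have "symbol_mat (vec_of_list [\<theta>1, \<theta>2, \<theta>3]) z \<mu> = M"
    unfolding symbol_mat_def Let_def M_def w_def
    by (rule eq_matI)
      (auto simp: less4 subdiag_mat_def mat_of_row_def mat_of_cols_def
        vec_of_list_index numeral_2_eq_2 add.commute)
  moreover have M: "M \<in> carrier_mat 4 4"
    by (simp add: M_def)
  moreover have "det M = z * w ^ 3 - \<mu>\<^sup>2 * (of_real \<theta>1 * w\<^sup>2 + of_real \<theta>2 * w + of_real \<theta>3)"
  proof -
    have four: "{..<4::nat} = {0, 1, 2, 3}"
      by auto
    have col: "M $$ (0, 3) = \<mu> * of_real \<theta>3" "M $$ (1, 3) = 0" "M $$ (2, 3) = 0" "M $$ (3, 3) = w"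
      by (simp_all add: M_def)
    have minor: "mat_delete M i 3 \<in> carrier_mat 3 3" for i
      using mat_delete_carrier[OF M] by simp
    have det0: "det (mat_delete M 0 3) = \<mu>"
      unfolding det_dim_three[OF minor] by (simp add: mat_delete_def M_def)
    have det3: "det (mat_delete M 3 3)
        = z * w\<^sup>2 - \<mu>\<^sup>2 * (of_real \<theta>1 * w + of_real \<theta>2)"
      unfolding det_dim_three[OF minor]
      by (simp add: mat_delete_def M_def algebra_simps power2_eq_square)
    have "det M = (\<Sum>i<4. M $$ (i, 3) * cofactor M i 3)"
      by (rule laplace_expansion_column[OF M]) simp
    then have "det M = w * det (mat_delete M 3 3) - \<mu> * of_real \<theta>3 * det (mat_delete M 0 3)"
      by (simp add: four col[unfolded One_nat_def] cofactor_def)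
    then show ?thesis
      unfolding det0 det3 by (simp add: algebra_simps small_powers)
  qed
  ultimately show ?thesis
    by (simp add: dispersion_det_def w_def)
qed

definition pencil :: "real \<Rightarrow> real \<Rightarrow> real \<Rightarrow> real \<Rightarrow> complex \<Rightarrow> complex" where
  "pencil a b c \<sigma> z = of_real (1 - \<sigma>) * (z * (1 + z) ^ 3)
     + of_real \<sigma> * (of_real a * (1 + z)\<^sup>2 + of_real b * (1 + z) + of_real c)"

lemma dispersion_roots_3_iff:
  "z \<in> dispersion_roots (vec_of_list [\<theta>1, \<theta>2, \<theta>3]) \<xi> \<longleftrightarrow>
     pencil \<theta>1 \<theta>2 \<theta>3 (\<xi>\<^sup>2 / (1 + \<xi>\<^sup>2)) z = 0"
proof -
  define A where "A = z * (1 + z) ^ 3"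
  define B where "B = of_real \<theta>1 * (1 + z)\<^sup>2 + of_real \<theta>2 * (1 + z) + of_real \<theta>3"
  have pos: "1 + \<xi>\<^sup>2 > 0"
    by (simp add: add_pos_nonneg)
  have "1 - \<xi>\<^sup>2 / (1 + \<xi>\<^sup>2) = 1 / (1 + \<xi>\<^sup>2)"
    using pos by (simp add: field_simps)
  then have "pencil \<theta>1 \<theta>2 \<theta>3 (\<xi>\<^sup>2 / (1 + \<xi>\<^sup>2)) z
      = of_real (1 / (1 + \<xi>\<^sup>2)) * A + of_real (\<xi>\<^sup>2 / (1 + \<xi>\<^sup>2)) * B"
    unfolding pencil_def A_def B_def by simp
  also have "\<dots> = of_real (1 / (1 + \<xi>\<^sup>2)) * (A + of_real (\<xi>\<^sup>2) * B)"
    by (simp add: add_divide_distrib mult.commute)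
  finally have 1: "pencil \<theta>1 \<theta>2 \<theta>3 (\<xi>\<^sup>2 / (1 + \<xi>\<^sup>2)) z
      = of_real (1 / (1 + \<xi>\<^sup>2)) * (A + of_real (\<xi>\<^sup>2) * B)" .
  have 2: "dispersion_det (vec_of_list [\<theta>1, \<theta>2, \<theta>3]) z (\<i> * of_real \<xi>) = A + of_real (\<xi>\<^sup>2) * B"
    unfolding dispersion_det_3 A_def B_def by (simp add: power_mult_distrib)
  show ?thesis
    unfolding dispersion_roots_def mem_Collect_eq 1 2 using pos
    by (metis divide_eq_0_iff less_irrefl mult_eq_0_iff of_real_eq_0_iff zero_neq_one)
qed

section \<open>The Hurwitz criterion for quartics\<close>

text \<open>
  The third Hurwitz determinant, which for a quartic of leading coefficient \<open>a4\<close> is \<open>a4\<^sup>3\<close> times the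
  product of the six pairwise sums of its roots.
\<close>

definition hurwitz4 :: "real \<Rightarrow> real \<Rightarrow> real \<Rightarrow> real \<Rightarrow> real \<Rightarrow> real" where
  "hurwitz4 a4 a3 a2 a1 a0 = a3 * a2 * a1 - a4 * a1\<^sup>2 - a3\<^sup>2 * a0"

definition quartic :: "real \<Rightarrow> real \<Rightarrow> real \<Rightarrow> real \<Rightarrow> real \<Rightarrow> complex \<Rightarrow> complex" where
  "quartic a4 a3 a2 a1 a0 z =
     of_real a4 * z ^ 4 + of_real a3 * z ^ 3 + of_real a2 * z\<^sup>2 + of_real a1 * z + of_real a0"

text \<open>
  The coefficients on the left are those of \<open>(z\<^sup>2 + p z + q) (a4 z\<^sup>2 + r z + t)\<close>. When the odd
  coefficients of the product are positive, the bracket on the right is too, so the Hurwitz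
  determinant has the sign of \<open>p r\<close>.
\<close>

lemma hurwitz4_product:
  "hurwitz4 a4 (r + a4 * p) (t + p * r + a4 * q) (p * t + q * r) (q * t)
     = p * r * ((a4 * q - t)\<^sup>2 + (r + a4 * p) * (p * t + q * r))"
  unfolding hurwitz4_def by (simp add: algebra_simps small_powers)

text \<open>
  A real root is negative because all coefficients are positive. A nonreal root \<open>z\<close> yields the
  real factor \<open>z\<^sup>2 + p z + q\<close> with \<open>p = - 2 Re z\<close>; if \<open>Re z \<ge> 0\<close> then \<open>p \<le> 0\<close>, which forces the linear
  coefficient \<open>r = a3 - a4 p\<close> of the cofactor to be positive, and \<open>hurwitz4_product\<close> makes the
  Hurwitz determinant nonpositive.
\<close>

lemma quartic_root_Re_neg:
  assumes pos: "a4 > 0" "a3 > 0" "a2 > 0" "a1 > 0" "a0 > 0"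
    and H: "hurwitz4 a4 a3 a2 a1 a0 > 0"
    and root: "quartic a4 a3 a2 a1 a0 z = 0"
  shows "Re z < 0"
proof (rule ccontr)
  assume "\<not> Re z < 0"
  then have x: "Re z \<ge> 0" by simp
  show False
  proof (cases "Im z = 0")
    case True
    then have z: "z = of_real (Re z)"
      by (simp add: complex_eq_iff)
    have "quartic a4 a3 a2 a1 a0 (of_real (Re z))
        = of_real (a4 * Re z ^ 4 + a3 * Re z ^ 3 + a2 * (Re z)\<^sup>2 + a1 * Re z + a0)"
      by (simp add: quartic_def)
    with root z have "a4 * Re z ^ 4 + a3 * Re z ^ 3 + a2 * (Re z)\<^sup>2 + a1 * Re z + a0 = 0"
      by (metis of_real_eq_0_iff)
    moreover have "a4 * Re z ^ 4 + a3 * Re z ^ 3 + a2 * (Re z)\<^sup>2 + a1 * Re z \<ge> 0"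
      using pos x by simp
    ultimately show False using pos by linarith
  next
    case False
    define p where "p = - 2 * Re z"
    define q where "q = (Re z)\<^sup>2 + (Im z)\<^sup>2"
    define r where "r = a3 - a4 * p"
    define t where "t = a2 - p * r - a4 * q"
    \<comment> \<open>\<open>r\<close> and \<open>t\<close> come from polynomial division; the linear remainder vanishes at a nonreal point,
      so both its coefficients are zero\<close>
    have quad: "z\<^sup>2 + of_real p * z + of_real q = 0"
      by (simp add: complex_eq_iff p_def q_def power2_eq_square)
    have "quartic a4 a3 a2 a1 a0 z
        = (z\<^sup>2 + of_real p * z + of_real q) * (of_real a4 * z\<^sup>2 + of_real r * z + of_real t)
          + of_real (a1 - p * t - q * r) * z + of_real (a0 - q * t)"
      unfolding quartic_def t_def r_def of_real_diff of_real_mult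
      by (simp add: algebra_simps small_powers)
    then have rem: "of_real (a1 - p * t - q * r) * z + of_real (a0 - q * t) = 0"
      using root quad by simp
    from arg_cong[OF rem, of Im] have a1: "a1 = p * t + q * r"
      using False by simp
    from arg_cong[OF rem, of Re] have a0: "a0 = q * t"
      using a1 by simp
    have "r > 0" "p \<le> 0"
      using x pos by (auto simp: r_def p_def intro: add_pos_nonneg)
    moreover have "hurwitz4 a4 a3 a2 a1 a0 = p * r * ((a4 * q - t)\<^sup>2 + a3 * a1)"
      using hurwitz4_product[of a4 r p t q] by (simp add: a1 a0 r_def t_def)
    moreover have "(a4 * q - t)\<^sup>2 + a3 * a1 > 0"
      using pos by (simp add: add_nonneg_pos)
    ultimately have "hurwitz4 a4 a3 a2 a1 a0 \<le> 0"
      by (metis less_imp_le mult_nonpos_nonneg)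
    with H show False by simp
  qed
qed

text \<open>
  At \<open>z = \<i> y\<close> the odd part of the quartic vanishes when \<open>y\<^sup>2 = a1 / a3\<close>, and for this \<open>y\<close> the even
  part is \<open>- hurwitz4 / a3\<^sup>2\<close>.
\<close>

lemma quartic_imaginary_root:
  assumes pos: "a3 > 0" "a1 > 0" and H: "hurwitz4 a4 a3 a2 a1 a0 = 0"
  shows "\<exists>y::real. quartic a4 a3 a2 a1 a0 (\<i> * of_real y) = 0"
proof -
  define y where "y = sqrt (a1 / a3)"
  have y2: "y\<^sup>2 = a1 / a3"
    using pos by (simp add: y_def)
  have odd: "a1 - a3 * y\<^sup>2 = 0"
    using pos y2 by simp
  have "a3\<^sup>2 * (a4 * (y\<^sup>2)\<^sup>2 - a2 * y\<^sup>2 + a0) = - hurwitz4 a4 a3 a2 a1 a0"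
    using pos unfolding y2 hurwitz4_def by (simp add: field_simps power2_eq_square)
  then have even: "a4 * (y\<^sup>2)\<^sup>2 - a2 * y\<^sup>2 + a0 = 0"
    using H pos by simp
  have "quartic a4 a3 a2 a1 a0 (\<i> * of_real y)
      = of_real (a4 * (y\<^sup>2)\<^sup>2 - a2 * y\<^sup>2 + a0) + \<i> * of_real y * of_real (a1 - a3 * y\<^sup>2)"
    by (simp add: quartic_def power_mult_distrib power3_eq_cube power4_eq_xxxx
        power2_eq_square algebra_simps)
  then have "quartic a4 a3 a2 a1 a0 (\<i> * of_real y) = 0"
    unfolding odd even by simp
  then show ?thesis by blast
qed

section \<open>Roots to the right of a shifted axis\<close>

text \<open>
  Taylor coefficients at \<open>- e\<close> of the pencil: \<open>shift0\<close>, \<open>shift1\<close> and \<open>shift2\<close> are those of degree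
  \<open>0, 1, 2\<close>, while those of degree \<open>3\<close> and \<open>4\<close> are \<open>(1 - \<sigma>) shift3\<close> and \<open>1 - \<sigma>\<close>. The factor \<open>1 - \<sigma>\<close>, which
  vanishes at infinite frequency, is kept apart so that it can be cancelled from the Hurwitz
  determinant.
\<close>

definition shift3 :: "real \<Rightarrow> real" where
  "shift3 e = 3 - 4 * e"

definition shift2 :: "real \<Rightarrow> real \<Rightarrow> real \<Rightarrow> real" where
  "shift2 a \<sigma> e = 3 * (1 - \<sigma>) * (1 - e) * (1 - 2 * e) + \<sigma> * a"

definition shift1 :: "real \<Rightarrow> real \<Rightarrow> real \<Rightarrow> real \<Rightarrow> real" where
  "shift1 a b \<sigma> e = (1 - \<sigma>) * (1 - e)\<^sup>2 * (1 - 4 * e) + \<sigma> * (2 * a * (1 - e) + b)"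

definition shift0 :: "real \<Rightarrow> real \<Rightarrow> real \<Rightarrow> real \<Rightarrow> real \<Rightarrow> real" where
  "shift0 a b c \<sigma> e = (1 - \<sigma>) * (- e) * (1 - e) ^ 3 + \<sigma> * (a * (1 - e)\<^sup>2 + b * (1 - e) + c)"

text \<open>
  The Hurwitz determinant of the shifted pencil divided by \<open>1 - \<sigma>\<close>; after this division the value
  at \<open>\<sigma> = 1\<close> retains information about the limit of infinite frequency.
\<close>

definition hurwitz_margin :: "real \<Rightarrow> real \<Rightarrow> real \<Rightarrow> real \<Rightarrow> real \<Rightarrow> real" where
  "hurwitz_margin a b c \<sigma> e = shift3 e * shift2 a \<sigma> e * shift1 a b \<sigma> e - (shift1 a b \<sigma> e)\<^sup>2
     - (1 - \<sigma>) * (shift3 e)\<^sup>2 * shift0 a b c \<sigma> e"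

lemma pencil_shift:
  "pencil a b c \<sigma> (z - of_real e) =
     quartic (1 - \<sigma>) ((1 - \<sigma>) * shift3 e) (shift2 a \<sigma> e) (shift1 a b \<sigma> e) (shift0 a b c \<sigma> e) z"
  unfolding pencil_def quartic_def shift3_def shift2_def shift1_def shift0_def
    of_real_add of_real_diff of_real_mult of_real_power of_real_1 of_real_numeral of_real_minus
  by (simp add: algebra_simps small_powers)

lemma hurwitz4_shift:
  "hurwitz4 (1 - \<sigma>) ((1 - \<sigma>) * shift3 e) (shift2 a \<sigma> e) (shift1 a b \<sigma> e) (shift0 a b c \<sigma> e)
     = (1 - \<sigma>) * hurwitz_margin a b c \<sigma> e"
  unfolding hurwitz4_def hurwitz_margin_def by (simp add: algebra_simps small_powers)

lemma shift_positive:
  assumes "a > 0" "b \<ge> 0" "0 \<le> \<sigma>" "\<sigma> < 1" "0 \<le> e" "e < 1 / 4"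
  shows "shift3 e > 0" "shift2 a \<sigma> e > 0" "shift1 a b \<sigma> e > 0"
  using assms unfolding shift3_def shift2_def shift1_def
  by (auto intro!: add_pos_nonneg mult_pos_pos mult_nonneg_nonneg add_nonneg_nonneg)

text \<open>
  The bound on \<open>\<sigma>\<close> is strict from below because the pencil has the root \<open>0\<close> at \<open>\<sigma> = 0\<close>. The shift must
  therefore vanish with \<open>\<sigma>\<close>: for \<open>e = g \<sigma>\<close> a common factor \<open>\<sigma>\<close> splits off, leaving a term of size at
  most \<open>g\<close> against at least \<open>a (3/4)\<^sup>2 > a / 2\<close>.
\<close>

lemma shift0_positive:
  assumes "a > 0" "b \<ge> 0" "c \<ge> 0" "0 < \<sigma>" "\<sigma> \<le> 1" "0 \<le> g" "g < 1 / 4" "g < a / 2"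
  shows "shift0 a b c \<sigma> (g * \<sigma>) > 0"
proof -
  define e where "e = g * \<sigma>"
  have "e \<le> g"
    using assms by (simp add: e_def mult_left_le)
  then have e: "0 \<le> e" "e < 1 / 4"
    using assms by (auto simp: e_def)
  have "(1 - e) ^ 3 \<le> 1"
    using e by (intro power_le_one) auto
  then have "(1 - \<sigma>) * (1 - e) ^ 3 \<le> 1"
    using assms e by (intro mult_le_one) auto
  then have "g * ((1 - \<sigma>) * (1 - e) ^ 3) \<le> g"
    using assms by (simp add: mult_left_le)
  moreover have "(3 / 4)\<^sup>2 \<le> (1 - e)\<^sup>2"
    using e by (intro power_mono) auto
  then have "a * (1 / 2) \<le> a * (1 - e)\<^sup>2"
    using assms by (intro mult_left_mono) (auto simp: power2_eq_square)
  moreover have "b * (1 - e) \<ge> 0"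
    using assms e by simp
  ultimately have "- (g * ((1 - \<sigma>) * (1 - e) ^ 3)) + (a * (1 - e)\<^sup>2 + b * (1 - e) + c) > 0"
    using assms by linarith
  moreover have "shift0 a b c \<sigma> e
      = \<sigma> * (- (g * ((1 - \<sigma>) * (1 - e) ^ 3)) + (a * (1 - e)\<^sup>2 + b * (1 - e) + c))"
    by (simp add: shift0_def e_def algebra_simps)
  ultimately show ?thesis
    using assms by (simp add: e_def)
qed

lemma continuous_on_hurwitz_margin:
  assumes "continuous_on S f" "continuous_on S h"
  shows "continuous_on S (\<lambda>x. hurwitz_margin a b c (f x) (h x))"
  unfolding hurwitz_margin_def shift3_def shift2_def shift1_def shift0_def
  by (intro continuous_intros assms)

text \<open>
  Compactness gives a positive minimum over the slice, and uniform continuity then one \<open>\<delta>\<close> for all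
  \<open>\<sigma>\<close>.
\<close>

lemma positive_near_compact_slice:
  fixes F :: "real \<Rightarrow> real \<Rightarrow> real"
  assumes cont: "continuous_on ({0..1} \<times> {0..1}) (\<lambda>x. F (fst x) (snd x))"
    and pos: "\<And>\<sigma>. \<sigma> \<in> {0..1} \<Longrightarrow> F \<sigma> 0 > 0"
  shows "\<exists>\<delta> > 0. \<forall>\<sigma> \<in> {0..1}. \<forall>g. 0 \<le> g \<longrightarrow> g < \<delta> \<longrightarrow> F \<sigma> g > 0"
proof -
  have cont0: "continuous_on {0..1} (\<lambda>\<sigma>. F \<sigma> 0)"
    using continuous_on_compose2[OF cont, of "{0..1}" "\<lambda>\<sigma>. (\<sigma>, 0)"]
    by (simp add: continuous_on_Pair image_subset_iff)
  obtain \<sigma>0 where \<sigma>0: "\<sigma>0 \<in> {0..1}" "\<And>\<sigma>. \<sigma> \<in> {0..1} \<Longrightarrow> F \<sigma>0 0 \<le> F \<sigma> 0"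
    using continuous_attains_inf[OF _ _ cont0] by auto
  have "uniformly_continuous_on ({0..1} \<times> {0..1}) (\<lambda>x. F (fst x) (snd x))"
    by (intro compact_uniformly_continuous cont compact_Times) auto
  then obtain d where d: "d > 0"
    "\<And>x y. x \<in> {0..1} \<times> {0..1} \<Longrightarrow> y \<in> {0..1} \<times> {0..1} \<Longrightarrow> dist y x < d
        \<Longrightarrow> dist (F (fst y) (snd y)) (F (fst x) (snd x)) < F \<sigma>0 0"
    using pos[OF \<sigma>0(1)] unfolding uniformly_continuous_on_def by meson
  show ?thesis
  proof (intro exI[of _ "min d 1"] conjI ballI allI impI)
    show "min d 1 > 0" using d by simp
    fix \<sigma> g :: real
    assume "\<sigma> \<in> {0..1}" "0 \<le> g" "g < min d 1"
    then have "dist (F \<sigma> g) (F \<sigma> 0) < F \<sigma>0 0"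
      using d(2)[of "(\<sigma>, 0)" "(\<sigma>, g)"] by (simp add: dist_Pair_Pair)
    then show "F \<sigma> g > 0"
      using \<sigma>0(2)[OF \<open>\<sigma> \<in> {0..1}\<close>] by (simp add: dist_real_def)
  qed
qed

section \<open>Decay and the Hurwitz determinant\<close>

lemma hurwitz_margin_unshifted:
  "hurwitz_margin a b c \<sigma> 0 = 8 * (1 - \<sigma>)\<^sup>2 + (8 * a - 2 * b - 9 * c) * \<sigma> * (1 - \<sigma>)
     + (2 * a + b) * (a - b) * \<sigma>\<^sup>2"
  unfolding hurwitz_margin_def shift3_def shift2_def shift1_def shift0_def
  by (simp add: algebra_simps small_powers)

lemma hurwitz_margin_at_one:
  "hurwitz_margin a b c 1 e = (2 * a * (1 - e) + b) * (a - b - 2 * a * e)"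
  unfolding hurwitz_margin_def shift3_def shift2_def shift1_def shift0_def
  by (simp add: algebra_simps small_powers)

text \<open>
  The rate \<open>g = 0\<close> is included: it describes the original quartic. Along \<open>e = g \<sigma>\<close> the margin starts
  at \<open>8\<close>, so without positivity the intermediate value theorem gives a frequency at which the
  shifted quartic has an imaginary root, i.e. a root of real part exactly \<open>- g \<sigma> > - c0 \<sigma>\<close>.
\<close>

lemma decay_imp_hurwitz_margin_pos:
  assumes par: "a > 0" "b \<ge> 0" and \<sigma>: "0 \<le> \<sigma>" "\<sigma> < 1"
    and g: "0 \<le> g" "g < 1 / 4" "g < c0"
    and decay: "\<And>\<sigma> z. 0 \<le> \<sigma> \<Longrightarrow> \<sigma> < 1 \<Longrightarrow> pencil a b c \<sigma> z = 0 \<Longrightarrow> Re z \<le> - (c0 * \<sigma>)"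
  shows "hurwitz_margin a b c \<sigma> (g * \<sigma>) > 0"
proof (rule ccontr)
  assume "\<not> hurwitz_margin a b c \<sigma> (g * \<sigma>) > 0"
  moreover have at0: "hurwitz_margin a b c 0 (g * 0) = 8"
    by (simp add: hurwitz_margin_unshifted)
  moreover have "continuous_on {0..\<sigma>} (\<lambda>\<sigma>. hurwitz_margin a b c \<sigma> (g * \<sigma>))"
    by (intro continuous_on_hurwitz_margin continuous_intros)
  ultimately obtain \<rho> where \<rho>: "0 \<le> \<rho>" "\<rho> \<le> \<sigma>" "hurwitz_margin a b c \<rho> (g * \<rho>) = 0"
    using IVT2'[of "\<lambda>\<sigma>. hurwitz_margin a b c \<sigma> (g * \<sigma>)" \<sigma> 0 0] \<sigma> by auto
  with at0 have "\<rho> \<noteq> 0" by auto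
  with \<rho> \<sigma> have \<rho>': "0 < \<rho>" "\<rho> < 1" by auto
  define e where "e = g * \<rho>"
  have "e \<le> g" using g \<rho>' by (simp add: e_def mult_left_le)
  then have e: "0 \<le> e" "e < 1 / 4" using g \<rho>' by (auto simp: e_def)
  have "\<exists>y::real. quartic (1 - \<rho>) ((1 - \<rho>) * shift3 e) (shift2 a \<rho> e) (shift1 a b \<rho> e)
      (shift0 a b c \<rho> e) (\<i> * of_real y) = 0"
  proof (rule quartic_imaginary_root)
    show "(1 - \<rho>) * shift3 e > 0" "shift1 a b \<rho> e > 0"
      using shift_positive[of a b \<rho> e] par \<rho>' e by auto
    show "hurwitz4 (1 - \<rho>) ((1 - \<rho>) * shift3 e) (shift2 a \<rho> e) (shift1 a b \<rho> e)
        (shift0 a b c \<rho> e) = 0"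
      using \<rho>(3) by (simp add: hurwitz4_shift e_def)
  qed
  then obtain y :: real where "pencil a b c \<rho> (\<i> * of_real y - of_real e) = 0"
    unfolding pencil_shift by blast
  from decay[OF _ _ this] \<rho>' have "c0 * \<rho> \<le> g * \<rho>"
    by (simp add: e_def)
  with \<rho>' g show False by simp
qed

text \<open>
  The endpoint \<open>\<sigma> = 1\<close> is where a positive decay rate says more than stability at every frequency:
  for \<open>b = a\<close> the margin at \<open>g = 0\<close> tends to \<open>0\<close> as \<open>\<sigma> \<rightarrow> 1\<close>, and only the limit with \<open>g > 0\<close>, in which
  \<open>a - b - 2 a g\<close> replaces \<open>a - b\<close>, excludes this case.
\<close>

lemma decay_iff_hurwitz_margin_pos:
  assumes par: "a > 0" "b \<ge> 0" "c \<ge> 0"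
  shows "(\<exists>c0 > 0. \<forall>\<sigma> z. 0 \<le> \<sigma> \<longrightarrow> \<sigma> < 1 \<longrightarrow> pencil a b c \<sigma> z = 0 \<longrightarrow> Re z \<le> - (c0 * \<sigma>))
     \<longleftrightarrow> (\<forall>\<sigma> \<in> {0..1}. hurwitz_margin a b c \<sigma> 0 > 0)"
proof
  assume "\<exists>c0 > 0. \<forall>\<sigma> z. 0 \<le> \<sigma> \<longrightarrow> \<sigma> < 1 \<longrightarrow> pencil a b c \<sigma> z = 0 \<longrightarrow> Re z \<le> - (c0 * \<sigma>)"
  then obtain c0 where c0: "c0 > 0"
    and decay: "\<And>\<sigma> z. 0 \<le> \<sigma> \<Longrightarrow> \<sigma> < 1 \<Longrightarrow> pencil a b c \<sigma> z = 0 \<Longrightarrow> Re z \<le> - (c0 * \<sigma>)"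
    by blast
  show "\<forall>\<sigma> \<in> {0..1}. hurwitz_margin a b c \<sigma> 0 > 0"
  proof
    fix \<sigma> :: real
    assume \<sigma>: "\<sigma> \<in> {0..1}"
    show "hurwitz_margin a b c \<sigma> 0 > 0"
    proof (cases "\<sigma> = 1")
      case False
      then show ?thesis
        using decay_imp_hurwitz_margin_pos[of a b \<sigma> 0 c0 c] par \<sigma> c0 decay by simp
    next
      case True
      define g where "g = min (1 / 8) (c0 / 2)"
      have g: "0 < g" "g < 1 / 4" "g < c0"
        using c0 by (auto simp: g_def)
      have "((\<lambda>\<sigma>. hurwitz_margin a b c \<sigma> (g * \<sigma>)) \<longlongrightarrow> hurwitz_margin a b c 1 (g * 1)) (at_left 1)"
      proof -
        have "continuous_on UNIV (\<lambda>\<sigma>. hurwitz_margin a b c \<sigma> (g * \<sigma>))"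
          by (intro continuous_on_hurwitz_margin continuous_intros)
        then show ?thesis
          unfolding continuous_on_eq_continuous_at[OF open_UNIV] isCont_def
          by (simp only: filterlim_at_split UNIV_I Ball_def)
      qed
      moreover have "\<forall>\<^sub>F \<sigma> in at_left 1. \<sigma> \<in> {0<..<1 :: real}"
        using eventually_at_left_real[of 0 "1 :: real"] by simp
      then have "\<forall>\<^sub>F \<sigma> in at_left 1. 0 \<le> hurwitz_margin a b c \<sigma> (g * \<sigma>)"
      proof eventually_elim
        case (elim \<sigma>)
        then show ?case
          using decay_imp_hurwitz_margin_pos[of a b \<sigma> g c0 c] par g decay
          by (simp add: less_imp_le)
      qed
      ultimately have "0 \<le> hurwitz_margin a b c 1 (g * 1)"
        by (rule tendsto_lowerbound) simp
      then have "0 \<le> (2 * a * (1 - g) + b) * (a - b - 2 * a * g)"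
        by (simp add: hurwitz_margin_at_one)
      moreover have "2 * a * (1 - g) + b > 0"
        using par g by (intro add_pos_nonneg) auto
      ultimately have "2 * a * g \<le> a - b"
        by (simp add: zero_le_mult_iff)
      then have "b < a"
        using mult_pos_pos[OF par(1) g(1)] by linarith
      then show ?thesis
        using par True by (simp add: hurwitz_margin_at_one)
    qed
  qed
next
  assume "\<forall>\<sigma> \<in> {0..1}. hurwitz_margin a b c \<sigma> 0 > 0"
  moreover have "continuous_on ({0..1} \<times> {0..1})
      (\<lambda>x. hurwitz_margin a b c (fst x) (snd x * fst x))"
    by (intro continuous_on_hurwitz_margin continuous_intros)
  ultimately have "\<exists>\<delta> > 0. \<forall>\<sigma> \<in> {0..1}. \<forall>g. 0 \<le> g \<longrightarrow> g < \<delta> \<longrightarrow> hurwitz_margin a b c \<sigma> (g * \<sigma>) > 0"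
    by (intro positive_near_compact_slice) simp_all
  then obtain \<delta> where \<delta>: "\<delta> > 0"
    and stab: "\<And>\<sigma> g. \<sigma> \<in> {0..1} \<Longrightarrow> 0 \<le> g \<Longrightarrow> g < \<delta> \<Longrightarrow> hurwitz_margin a b c \<sigma> (g * \<sigma>) > 0"
    by blast
  define g where "g = Min {\<delta> / 2, 1 / 8, a / 4}"
  have g: "0 < g" "g < \<delta>" "g < 1 / 4" "g < a / 2"
    using \<delta> par by (auto simp: g_def)
  have "Re z \<le> - (g * \<sigma>)" if \<sigma>: "0 \<le> \<sigma>" "\<sigma> < 1" and root: "pencil a b c \<sigma> z = 0" for \<sigma> z
  proof (cases "\<sigma> = 0")
    case True
    with root have "z = 0 \<or> 1 + z = 0"
      by (simp add: pencil_def)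
    then show ?thesis
      using True by (auto simp: add_eq_0_iff)
  next
    case False
    define e where "e = g * \<sigma>"
    have "e \<le> g" using g \<sigma> by (simp add: e_def mult_left_le)
    then have "e < 1 / 4" using g by linarith
    moreover have "0 \<le> e" using g \<sigma> by (simp add: e_def)
    ultimately have e: "0 \<le> e" "e < 1 / 4" by auto
    have "Re (z + of_real e) < 0"
    proof (rule quartic_root_Re_neg)
      show "1 - \<sigma> > 0" "(1 - \<sigma>) * shift3 e > 0" "shift2 a \<sigma> e > 0" "shift1 a b \<sigma> e > 0"
        using shift_positive[of a b \<sigma> e] par \<sigma> e by auto
      show "shift0 a b c \<sigma> e > 0"
        using shift0_positive[of a b c \<sigma> g] par \<sigma> g False by (simp add: e_def)
      show "hurwitz4 (1 - \<sigma>) ((1 - \<sigma>) * shift3 e) (shift2 a \<sigma> e) (shift1 a b \<sigma> e)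
          (shift0 a b c \<sigma> e) > 0"
        using stab[of \<sigma> g] \<sigma> g by (simp add: hurwitz4_shift e_def)
      show "quartic (1 - \<sigma>) ((1 - \<sigma>) * shift3 e) (shift2 a \<sigma> e) (shift1 a b \<sigma> e)
          (shift0 a b c \<sigma> e) (z + of_real e) = 0"
        using root by (simp flip: pencil_shift)
    qed
    then show ?thesis by (simp add: e_def)
  qed
  with g(1) show "\<exists>c0 > 0. \<forall>\<sigma> z. 0 \<le> \<sigma> \<longrightarrow> \<sigma> < 1 \<longrightarrow> pencil a b c \<sigma> z = 0 \<longrightarrow> Re z \<le> - (c0 * \<sigma>)"
    by blast
qed

section \<open>The algebraic form of the condition\<close>

lemma binary_quadratic_pos_iff:
  fixes A B C :: real
  assumes "C > 0"
  shows "(\<forall>\<sigma> \<in> {0..1}. C * (1 - \<sigma>)\<^sup>2 + B * \<sigma> * (1 - \<sigma>) + A * \<sigma>\<^sup>2 > 0)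
     \<longleftrightarrow> A > 0 \<and> (B \<ge> 0 \<or> B\<^sup>2 < 4 * C * A)"
proof
  assume pos: "\<forall>\<sigma> \<in> {0..1}. C * (1 - \<sigma>)\<^sup>2 + B * \<sigma> * (1 - \<sigma>) + A * \<sigma>\<^sup>2 > 0"
  have A: "A > 0"
    using pos[rule_format, of 1] by simp
  moreover have "B\<^sup>2 < 4 * C * A" if "B < 0"
  proof -
    \<comment> \<open>the weights \<open>\<sigma> : 1 - \<sigma>\<close> are \<open>- B : 2 A\<close>, the ratio that minimises the form relative to \<open>(1 - \<sigma>)\<^sup>2\<close>\<close>
    define n where "n = 2 * A - B"
    have n: "n > 0" using A that by (simp add: n_def)
    define \<sigma> where "\<sigma> = - B / n"
    have \<sigma>: "n * \<sigma> = - B" "n * (1 - \<sigma>) = 2 * A"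
    proof -
      show "n * \<sigma> = - B" using n by (simp add: \<sigma>_def)
      then show "n * (1 - \<sigma>) = 2 * A" by (simp add: right_diff_distrib n_def)
    qed
    have "\<sigma> \<in> {0..1}"
      using n that A by (auto simp: \<sigma>_def n_def field_simps)
    with pos n have "0 < n\<^sup>2 * (C * (1 - \<sigma>)\<^sup>2 + B * \<sigma> * (1 - \<sigma>) + A * \<sigma>\<^sup>2)"
      by simp
    also have "\<dots> = C * (n * (1 - \<sigma>))\<^sup>2 + B * (n * \<sigma>) * (n * (1 - \<sigma>)) + A * (n * \<sigma>)\<^sup>2"
      by (simp add: algebra_simps small_powers)
    also have "\<dots> = A * (4 * C * A - B\<^sup>2)"
      unfolding \<sigma> by (simp add: algebra_simps small_powers)
    finally show ?thesis
      using A by (simp add: zero_less_mult_iff)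
  qed
  ultimately show "A > 0 \<and> (B \<ge> 0 \<or> B\<^sup>2 < 4 * C * A)"
    by linarith
next
  assume *: "A > 0 \<and> (B \<ge> 0 \<or> B\<^sup>2 < 4 * C * A)"
  show "\<forall>\<sigma> \<in> {0..1}. C * (1 - \<sigma>)\<^sup>2 + B * \<sigma> * (1 - \<sigma>) + A * \<sigma>\<^sup>2 > 0"
  proof
    fix \<sigma> :: real
    assume \<sigma>: "\<sigma> \<in> {0..1}"
    show "C * (1 - \<sigma>)\<^sup>2 + B * \<sigma> * (1 - \<sigma>) + A * \<sigma>\<^sup>2 > 0"
    proof (cases "\<sigma> = 0")
      case True
      then show ?thesis using assms by simp
    next
      case False
      show ?thesis
      proof (cases "B \<ge> 0")
        case True
        then have "B * \<sigma> * (1 - \<sigma>) \<ge> 0" "C * (1 - \<sigma>)\<^sup>2 \<ge> 0" "A * \<sigma>\<^sup>2 > 0"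
          using \<sigma> False assms * by auto
        then show ?thesis by linarith
      next
        case neg: False
        have "4 * C * (C * (1 - \<sigma>)\<^sup>2 + B * \<sigma> * (1 - \<sigma>) + A * \<sigma>\<^sup>2)
            = (2 * C * (1 - \<sigma>) + B * \<sigma>)\<^sup>2 + (4 * C * A - B\<^sup>2) * \<sigma>\<^sup>2"
          by (simp add: algebra_simps small_powers)
        also have "\<dots> > 0"
          using * neg False by (intro add_nonneg_pos) auto
        finally show ?thesis
          using assms by (simp add: zero_less_mult_iff)
      qed
    qed
  qed
qed

text \<open>
  With \<open>B = 8 a - 2 b - 9 c\<close> and \<open>D\<close> one ninth of the discriminant, the conditions \<open>B \<ge> 0 \<or> D < 0\<close> and
  \<open>3 c < 2 a \<or> D < 0\<close> agree for \<open>b < a\<close>. Indeed \<open>3 c < 2 a\<close> implies \<open>B > 0\<close>, and in the gap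
  \<open>2 a / 3 \<le> c \<le> (8 a - 2 b) / 9\<close> between the two conditions \<open>D\<close>, a convex function of \<open>c\<close>, is
  negative at both ends.
\<close>

lemma hurwitz_margin_pos_iff:
  assumes par: "a > 0" "b \<ge> 0" "c \<ge> 0"
  shows "(\<forall>\<sigma> \<in> {0..1}. hurwitz_margin a b c \<sigma> 0 > 0) \<longleftrightarrow>
     b < a \<and> (3 * c < 2 * a \<or> (2 * b + c)\<^sup>2 + 8 * (c - a)\<^sup>2 < 8 * a\<^sup>2)"
proof -
  define A where "A = (2 * a + b) * (a - b)"
  define B where "B = 8 * a - 2 * b - 9 * c"
  define D where "D = (2 * b + c)\<^sup>2 + 8 * (c - a)\<^sup>2 - 8 * a\<^sup>2"
  have A: "A > 0 \<longleftrightarrow> b < a"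
    using par by (auto simp: A_def zero_less_mult_iff)
  have disc: "B\<^sup>2 - 4 * 8 * A = 9 * D"
    unfolding A_def B_def D_def by (simp add: algebra_simps small_powers)
  have "(B \<ge> 0 \<or> D < 0) \<longleftrightarrow> (3 * c < 2 * a \<or> D < 0)" if ab: "b < a"
  proof -
    have "B \<ge> 0" if "3 * c < 2 * a"
      using that ab by (simp add: B_def)
    moreover have "D < 0" if "B \<ge> 0" "3 * c \<ge> 2 * a"
    proof -
      \<comment> \<open>convexity in \<open>c\<close> made explicit: the first term vanishes at both ends of the gap and the
        remaining two interpolate the end values linearly\<close>
      have "D = - (1 / 3) * ((3 * c - 2 * a) * B) - (2 / 3) * ((a - b) * (3 * c - 2 * a))
          - (4 / 3) * ((a - b) * (3 * b + 5 * a))"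
        unfolding D_def B_def by (simp add: power2_eq_square algebra_simps)
      moreover have "(3 * c - 2 * a) * B \<ge> 0" "(a - b) * (3 * c - 2 * a) \<ge> 0"
        "(a - b) * (3 * b + 5 * a) > 0"
        using that ab par by auto
      ultimately show ?thesis by linarith
    qed
    ultimately show ?thesis by linarith
  qed
  then show ?thesis
    unfolding hurwitz_margin_unshifted
    using binary_quadratic_pos_iff[of 8 B A] A disc by (auto simp: A_def B_def D_def)
qed

theorem theorem1p3:
  fixes \<theta>1 \<theta>2 \<theta>3 :: real
  assumes "\<theta>1 > 0" and "\<theta>2 \<ge> 0" and "\<theta>3 \<ge> 0"
  shows "(\<exists>c0 > 0. \<forall>\<xi>::real. \<forall>z \<in> dispersion_roots (vec_of_list [\<theta>1, \<theta>2, \<theta>3]) \<xi>.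
            Re z \<le> - (c0 * \<bar>\<xi>\<bar> ^ 2) / (1 + \<bar>\<xi>\<bar> ^ 2))
     \<longleftrightarrow>
     \<theta>2 < \<theta>1 \<and>
       (3 * \<theta>3 < 2 * \<theta>1 \<or> (2 * \<theta>2 + \<theta>3) ^ 2 + 8 * (\<theta>3 - \<theta>1) ^ 2 < 8 * \<theta>1 ^ 2)"
proof -
  have all_\<sigma>: "(\<forall>\<xi>::real. P (\<xi>\<^sup>2 / (1 + \<xi>\<^sup>2))) \<longleftrightarrow> (\<forall>\<sigma>. 0 \<le> \<sigma> \<longrightarrow> \<sigma> < 1 \<longrightarrow> P \<sigma>)" for P
  proof (intro iffI allI impI)
    fix \<sigma> :: real
    assume P: "\<forall>\<xi>::real. P (\<xi>\<^sup>2 / (1 + \<xi>\<^sup>2))" and \<sigma>: "0 \<le> \<sigma>" "\<sigma> < 1"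
    define \<xi> where "\<xi> = sqrt (\<sigma> / (1 - \<sigma>))"
    have "\<xi>\<^sup>2 = \<sigma> / (1 - \<sigma>)"
      using \<sigma> by (simp add: \<xi>_def)
    moreover have "1 + \<sigma> / (1 - \<sigma>) = 1 / (1 - \<sigma>)"
      using \<sigma> by (simp add: field_simps)
    ultimately have "\<xi>\<^sup>2 / (1 + \<xi>\<^sup>2) = \<sigma>"
      using \<sigma> by simp
    with P show "P \<sigma>" by metis
  next
    fix \<xi> :: real
    assume "\<forall>\<sigma>. 0 \<le> \<sigma> \<longrightarrow> \<sigma> < 1 \<longrightarrow> P \<sigma>"
    then show "P (\<xi>\<^sup>2 / (1 + \<xi>\<^sup>2))"
      by (simp add: add_pos_nonneg)
  qed
  have "(\<forall>\<xi>::real. \<forall>z \<in> dispersion_roots (vec_of_list [\<theta>1, \<theta>2, \<theta>3]) \<xi>.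
            Re z \<le> - (c0 * \<bar>\<xi>\<bar> ^ 2) / (1 + \<bar>\<xi>\<bar> ^ 2))
     \<longleftrightarrow> (\<forall>\<sigma> z. 0 \<le> \<sigma> \<longrightarrow> \<sigma> < 1 \<longrightarrow> pencil \<theta>1 \<theta>2 \<theta>3 \<sigma> z = 0 \<longrightarrow> Re z \<le> - (c0 * \<sigma>))" for c0
    using all_\<sigma>[of "\<lambda>\<sigma>. \<forall>z. pencil \<theta>1 \<theta>2 \<theta>3 \<sigma> z = 0 \<longrightarrow> Re z \<le> - (c0 * \<sigma>)"]
    by (simp add: Ball_def dispersion_roots_3_iff del: vec_of_list_Cons)
  then show ?thesis
    using decay_iff_hurwitz_margin_pos[OF assms] hurwitz_margin_pos_iff[OF assms] by simp
qed

end
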